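(* Consider the system for $(\bar m^P,\bar m^X,\bar u^* )$ on $t\ge 0$: $$ \begin{cases} d\bar m^P_t=\alpha[\beta-(1-\lambda\gamma)\bar m^X_t-\bar m^P_t]\,dt,& \bar m^P_0=p_0,\\ d\bar m^X_t=(-\mu\bar m^X_t+\bar u^*_t)\,dt,& \bar m^X_0=x_0,\\ d\bar u^*_t=\left[(\mu+\rho)\bar u^*_t-\frac{1-c}{2r}\bar m^P_t\right]dt,& \bar u^*_0=\frac{1-c}{2r}\int_0^\infty e^{-(\mu+\rho)t}\bar m^P_t\,dt. \end{cases} $$ This system has a unique solution $(\bar m^P,\bar m^X,\bar u^* )\in C_b([0,\infty);\mathbb{R})^3$. Moreover, with $A,B,\Delta,K_1,K_2,K_R,K_I$ as defined in the context and $$p^*=\frac{\alpha\mu\beta(\mu+\rho)}{B},$$ the component $\bar m^P=(\bar m^P_t)_{t\ge0}$ admits the following closed-form representation. (i) If $\Delta>0$, $$ \bar m^P_t=\frac{-\alpha(\beta-(1-\lambda\gamma)x_0-p_0)+(p_0-p^* )K_2}{K_2-K_1}e^{K_1t}+\frac{\alpha(\beta-(1-\lambda\gamma)x_0-p_0)-(p_0-p^* )K_1}{K_2-K_1}e^{K_2t}+p^*. $$ (ii) If $\Delta=0$, $$ \bar m^P_t=p^*+e^{K_1t}\left\{p_0-p^*+\left[\alpha(\beta-(1-\lambda\gamma)x_0-p_0)-K_1(p_0-p^* )\right]t\right\}. $$ (iii) If $\Delta<0$, $$ \bar m^P_t=p^*+e^{K_Rt}\left[\frac{-\alpha(\beta-(1-\lambda\gamma)x_0-p_0)+(p_0-p^*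 )K_I}{K_I-K_R}\cos(K_It)+\frac{\alpha(\beta-(1-\lambda\gamma)x_0-p_0)-(p_0-p^* )K_R}{K_I-K_R}\sin(K_Rt)\right]. $$
   Context: Constants: $\alpha,\beta,\rho>0$, $p_0>0$, $x_0\in\mathbb{R}$, and $\theta=(\mu,\sigma,\gamma,\lambda,r,c)\in(0,\infty)^6$, where $\theta$ is the limit as $i\to\infty$ of vectors $\theta_i=(\mu_i,\sigma_i,\gamma_i,\lambda_i,r_i,c_i)\in(0,\infty)^6$ with $c_i\in(0,1)$, $\sigma_i^2<2\mu_i$ and $1-\gamma_i\lambda_i>0$ for all $i\in\mathbb{N}$. $C_b([0,\infty);\mathbb{R})$ is the set of bounded continuous functions from $[0,\infty)$ to $\mathbb{R}$. Define $$A:=\mu^2+\rho\mu+\alpha\rho>0,\qquad B:=\alpha\left[\mu(\mu+\rho)+\frac{(1-\lambda\gamma)(1-c)}{2r}\right]>0,$$ and let $\Delta$ be the discriminant of the cubic equation $K^3+(\alpha-\rho)K^2-AK-B=0$ in the unknown $K$: $$\Delta:=-27B^2+[18(\alpha-\rho)A+4(\alpha-\rho)^3]B+[(\alpha-\rho)^2A^2+4A^3].$$ The roots of the cubic are denoted as follows. If $\Delta>0$, there are three roots $K_1,K_2,K_3$ with $K_1<K_2<0<K_3$. If $\Delta=0$, there are two roots $K_1,K_2$ with $K_1<0<K_2$. If $\Delta<0$, there are three roots $K_1,K_2\in\mathbb{C}$ and $K_3>0$, where $K_1=K_R+K_I\mathrm{i}$ and $K_2=K_R-K_I\mathrm{i}$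 for some $K_R<0$ and $K_I\ne0$.
   Formalization: In case (iii) the printed formula violates m^P_0=p_0; it is replaced by p*+e^{K_R t}[(p_0-p* )cos(K_I t)+((q-(p_0-p* )K_R)/K_I) sin(K_I t)], where q=α(β-(1-λγ)x_0-p_0). *)

theory Defs
  imports "HOL-Analysis.Analysis"
begin

text \<open>
  Functions on $[0,\infty)$ are represented by total functions that are
  \<^const>\<open>undefined\<close> on the negative reals, so that equality of elements of
  \<open>Cb\<close> is equality on $[0,\infty)$ and uniqueness can be stated with \<open>\<exists>!\<close>.
\<close>

definition Cb :: "(real \<Rightarrow> real) set" where
  "Cb = {f \<in> extensional {0..}. continuous_on {0..} f \<and> bounded (f ` {0..})}"

text \<open>
  The derivative at $0$ is one-sided. For \<open>P\<close> in \<open>Cb\<close> the integrand in the initial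
  condition of \<open>u\<close> is absolutely integrable, hence the integral is a genuine one.
\<close>

definition mf_system ::
  "real \<Rightarrow> real \<Rightarrow> real \<Rightarrow> real \<Rightarrow> real \<Rightarrow> real \<Rightarrow> real \<Rightarrow> real \<Rightarrow> real \<Rightarrow> real \<Rightarrow>
   (real \<Rightarrow> real) \<Rightarrow> (real \<Rightarrow> real) \<Rightarrow> (real \<Rightarrow> real) \<Rightarrow> bool" where
  "mf_system \<alpha> \<beta> \<rho> \<mu> \<gamma> lam r c p0 x0 P X u \<longleftrightarrow>
     (\<forall>t\<ge>0. (P has_real_derivative \<alpha> * (\<beta> - (1 - lam * \<gamma>) * X t - P t)) (at t within {0..})) \<and>
     (\<forall>t\<ge>0. (X has_real_derivative - \<mu> * X t + u t) (at t within {0..})) \<and>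
     (\<forall>t\<ge>0. (u has_real_derivative (\<mu> + \<rho>) * u t - (1 - c) / (2 * r) * P t) (at t within {0..})) \<and>
     P 0 = p0 \<and>
     X 0 = x0 \<and>
     u 0 = (1 - c) / (2 * r) * integral {0..} (\<lambda>t. exp (- (\<mu> + \<rho>) * t) * P t)"

definition coeff_A :: "real \<Rightarrow> real \<Rightarrow> real \<Rightarrow> real" where
  "coeff_A \<alpha> \<rho> \<mu> = \<mu>\<^sup>2 + \<rho> * \<mu> + \<alpha> * \<rho>"

definition coeff_B :: "real \<Rightarrow> real \<Rightarrow> real \<Rightarrow> real \<Rightarrow> real \<Rightarrow> real \<Rightarrow> real \<Rightarrow> real" where
  "coeff_B \<alpha> \<rho> \<mu> \<gamma> lam r c =
     \<alpha> * (\<mu> * (\<mu> + \<rho>) + (1 - lam * \<gamma>) * (1 - c) / (2 * r))"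

text \<open>Below, \<open>A\<close> and \<open>B\<close> stand for the values of \<open>coeff_A\<close> and \<open>coeff_B\<close>.\<close>

definition cubic_discr :: "real \<Rightarrow> real \<Rightarrow> real \<Rightarrow> real \<Rightarrow> real" where
  "cubic_discr \<alpha> \<rho> A B =
     - 27 * B\<^sup>2 + (18 * (\<alpha> - \<rho>) * A + 4 * (\<alpha> - \<rho>)^3) * B + ((\<alpha> - \<rho>)\<^sup>2 * A\<^sup>2 + 4 * A^3)"

definition cubic_roots :: "real \<Rightarrow> real \<Rightarrow> real \<Rightarrow> real \<Rightarrow> complex set" where
  "cubic_roots \<alpha> \<rho> A B =
     {K. K^3 + of_real (\<alpha> - \<rho>) * K\<^sup>2 - of_real A * K - of_real B = 0}"

definition p_star :: "real \<Rightarrow> real \<Rightarrow> real \<Rightarrow> real \<Rightarrow> real \<Rightarrow> real" where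
  "p_star \<alpha> \<beta> \<rho> \<mu> B = \<alpha> * \<mu> * \<beta> * (\<mu> + \<rho>) / B"

text \<open>
  A deviation from the source in the case of a negative discriminant. With
  $q = \alpha(\beta-(1-\lambda\gamma)x_0-p_0)$, which is the initial slope of the price,
  the source prints
  $$p^* + e^{K_R t}\left[\frac{-q+(p_0-p^*)K_I}{K_I-K_R}\cos(K_I t)
      + \frac{q-(p_0-p^*)K_R}{K_I-K_R}\sin(K_R t)\right],$$
  whose value at $t = 0$ differs from $p_0$ unless $q = (p_0-p^*)K_R$ (and which need not be
  defined, as $K_I = K_R$ is possible). It is the real form, with the coefficients
  miscalculated, of the combination of $e^{(K_R+K_I i)t}$ and $e^{(K_R-K_I i)t}$
  that has value $p_0-p^*$ and slope $q$ at $0$. The theorem states that combination: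
  $$p^* + e^{K_R t}\left[(p_0-p^*)\cos(K_I t)
      + \frac{q-(p_0-p^*)K_R}{K_I}\sin(K_I t)\right].$$
\<close>

end

theory Submission
  imports Defs
begin

text \<open>
  Put \<open>\<eta> = 1 - lam \<gamma>\<close> and \<open>k = (1 - c) / (2 r)\<close>; both are nonnegative, being limits of positive
  quantities. Eliminating \<open>X\<close> and \<open>u\<close> from the three linear equations shows that the characteristic
  polynomial of the system is the cubic of the theorem, which can be written as
  \<open>(K + \<alpha>) (K + \<mu>) (K - (\<mu> + \<rho>)) - \<alpha> \<eta> k\<close>, and that \<open>p\<^sup>*\<close> is the equilibrium price.

  The cubic is nonpositive at \<open>\<mu> + \<rho>\<close>, so it has a real root \<open>\<kappa> \<ge> \<mu> + \<rho>\<close>, and it factors as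
  \<open>(K - \<kappa>) (K\<^sup>2 - s K + d)\<close>. Since \<open>\<kappa> > \<rho> - \<alpha>\<close> and \<open>B > 0\<close>, one has \<open>s < 0 < d\<close>: the other two
  roots lie in the open left half-plane (\<open>cubic_factorization\<close>). The discriminant of the cubic is a
  positive multiple of \<open>s\<^sup>2 - 4 d\<close>, and so its sign decides the type of these two roots.

  Boundedness kills the growing mode. Along a bounded solution, the expression
  \<open>P'' - s P' + d (P - p\<^sup>*)\<close> is a combination of \<open>P\<close>, \<open>X\<close>, \<open>u\<close> and constants, hence bounded, and it
  is a constant multiple of \<open>exp (\<kappa> t)\<close>; therefore it vanishes (\<open>bounded_flow_oscillator\<close>). So \<open>P - p\<^sup>*\<close> is a damped
  oscillator, \<open>y'' = s y' - d y\<close>, with known value and slope at \<open>0\<close>. The energy \<open>d y\<^sup>2 + y'\<^sup>2\<close> does not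
  increase, which makes oscillators bounded and determined by their initial data. This gives the
  closed forms, since each of them is an oscillator with the right data, and uniqueness of \<open>P\<close>;
  then \<open>u\<close> is unique because the difference of two candidates would be a growing mode, and \<open>X\<close>
  because its initial value is prescribed.

  Conversely, given the oscillator, a suitable combination of \<open>y\<close>, \<open>y'\<close> and a constant solves the
  equation for \<open>u\<close>, variation of constants produces \<open>X\<close>, and the factorization of the cubic makes
  the price equation hold (\<open>bounded_flow_exists\<close>). Integrating the equation for \<open>u\<close> against
  \<open>exp (- (\<mu> + \<rho>) t)\<close> turns boundedness of \<open>u\<close> into the integral formula for \<open>u 0\<close>
  (\<open>discounted_integral\<close>).
\<close>

section \<open>Linear differential inequalities and equations on the half-line\<close>

lemma halfline_nonincreasing:
  fixes f f' :: "real \<Rightarrow> real"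
  assumes f: "\<And>t. 0 \<le> t \<Longrightarrow> (f has_real_derivative f' t) (at t within {0..})"
    and le: "\<And>t. 0 \<le> t \<Longrightarrow> f' t \<le> 0"
    and t: "0 \<le> t"
  shows "f t \<le> f 0"
proof -
  have "(f has_derivative (\<lambda>h. f' x * h)) (at x within {0..t})" if "0 \<le> x" "x \<le> t" for x
    using f[OF that(1)] has_derivative_subset unfolding has_field_derivative_def
    by (metis atLeast_iff atLeastAtMost_iff subsetI)
  from mvt_very_simple[OF t this] obtain x where "x \<in> {0..t}" "f t - f 0 = f' x * (t - 0)"
    by auto
  moreover from this have "f' x * (t - 0) \<le> 0"
    using le[of x] t by (auto intro: mult_nonpos_nonneg)
  ultimately show ?thesis by linarith
qed

lemma exponential_solution:
  fixes w :: "real \<Rightarrow> real"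
  assumes w: "\<And>t. 0 \<le> t \<Longrightarrow> (w has_real_derivative K * w t) (at t within {0..})"
    and t: "0 \<le> t"
  shows "w t = w 0 * exp (K * t)"
proof -
  define f where "f = (\<lambda>t. w t * exp (- K * t))"
  have f: "(f has_real_derivative 0) (at t within {0..})" if "0 \<le> t" for t
    unfolding f_def by (rule derivative_eq_intros w that refl)+ (simp add: algebra_simps)
  have "f t \<le> f 0"
    by (rule halfline_nonincreasing[of f "\<lambda>_. 0"]) (use f t in auto)
  moreover have "- f t \<le> - f 0"
    by (rule halfline_nonincreasing[of "\<lambda>t. - f t" "\<lambda>_. 0"])
      (use f t in \<open>auto intro!: derivative_eq_intros\<close>)
  ultimately have "w t * exp (- K * t) = w 0"
    by (simp add: f_def)
  then show ?thesis
    by (simp add: exp_minus field_simps)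
qed

text \<open>
  By \<open>exponential_solution\<close> a nonzero \<open>w\<close> would leave every bound. With \<open>exp x \<ge> 1 + x\<close> the time
  \<open>M / (\<bar>w 0\<bar> K)\<close> is already late enough to exceed a bound \<open>M\<close>.
\<close>

lemma bounded_growing_mode_vanishes:
  fixes w :: "real \<Rightarrow> real"
  assumes w: "\<And>t. 0 \<le> t \<Longrightarrow> (w has_real_derivative K * w t) (at t within {0..})"
    and bdd: "bounded (w ` {0..})" and K: "K > 0" and t: "0 \<le> t"
  shows "w t = 0"
proof -
  obtain M where M: "\<And>t. 0 \<le> t \<Longrightarrow> \<bar>w t\<bar> \<le> M"
    using bdd by (auto simp: bounded_iff)
  have "w 0 = 0"
  proof (rule ccontr)
    assume nz: "w 0 \<noteq> 0"
    define T where "T = M / (\<bar>w 0\<bar> * K)"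
    have "M \<ge> 0" using M[of 0] by simp
    then have T: "T \<ge> 0" using K by (simp add: T_def)
    have "\<bar>w 0\<bar> * (1 + K * T) \<le> \<bar>w 0\<bar> * exp (K * T)"
      by (intro mult_left_mono) auto
    also have "\<dots> = \<bar>w T\<bar>"
      using exponential_solution[of w K T, OF w T] by (simp add: abs_mult)
    also have "\<dots> \<le> M" by (rule M[OF T])
    finally have "\<bar>w 0\<bar> + \<bar>w 0\<bar> * K * T \<le> M"
      by (simp add: algebra_simps)
    moreover have "\<bar>w 0\<bar> * K * T = M" using nz K by (simp add: T_def)
    ultimately show False using nz by simp
  qed
  then show ?thesis using exponential_solution[of w K t, OF w t] by simp
qed

text \<open>
  A one-sided comparison with the stationary solution \<open>M / \<mu>\<close> of \<open>X' = - \<mu> X + M\<close>: the function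
  \<open>exp (\<mu> t) (X t - M / \<mu>)\<close> does not increase. Two-sided bounds follow by applying it to \<open>- X\<close>.
\<close>

lemma damped_linear_upper_bound:
  fixes X u :: "real \<Rightarrow> real"
  assumes X: "\<And>t. 0 \<le> t \<Longrightarrow> (X has_real_derivative - \<mu> * X t + u t) (at t within {0..})"
    and u: "\<And>t. 0 \<le> t \<Longrightarrow> u t \<le> M"
    and pos: "\<mu> > 0" "M \<ge> 0" and t: "0 \<le> t"
  shows "X t \<le> \<bar>X 0\<bar> + M / \<mu>"
proof -
  define g where "g = (\<lambda>t. exp (\<mu> * t) * (X t - M / \<mu>))"
  have "(g has_real_derivative exp (\<mu> * t) * (u t - M)) (at t within {0..})" if "0 \<le> t" for t
    unfolding g_def using pos
    by - (rule derivative_eq_intros X that refl | simp add: field_simps)+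
  moreover have "exp (\<mu> * t) * (u t - M) \<le> 0" if "0 \<le> t" for t
    using u[OF that] by (auto intro: mult_nonneg_nonpos)
  ultimately have "g t \<le> g 0"
    by (rule halfline_nonincreasing[OF _ _ t])
  also have "\<dots> \<le> \<bar>X 0\<bar>"
    using pos by (simp add: g_def abs_le_iff)
      (smt (verit) divide_nonneg_nonneg)
  finally have "X t - M / \<mu> \<le> \<bar>X 0\<bar> * exp (- (\<mu> * t))"
    by (simp add: g_def exp_minus field_simps)
  also have "\<dots> \<le> \<bar>X 0\<bar> * 1"
    using pos t by (intro mult_left_mono) auto
  finally show ?thesis by simp
qed

lemma damped_linear_solution_exists:
  fixes u :: "real \<Rightarrow> real"
  assumes cont: "continuous_on {0..} u" and bdd: "bounded (u ` {0..})" and \<mu>: "\<mu> > 0"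
  shows "\<exists>X. X 0 = x0 \<and> bounded (X ` {0..}) \<and>
    (\<forall>t\<ge>0. (X has_real_derivative - \<mu> * X t + u t) (at t within {0..}))"
proof -
  define I where "I = (\<lambda>t. integral {0..t} (\<lambda>s. exp (\<mu> * s) * u s))"
  define X where "X = (\<lambda>t. exp (- \<mu> * t) * (x0 + I t))"
  have I: "(I has_real_derivative exp (\<mu> * t) * u t) (at t within {0..})" if "0 \<le> t" for t
  proof -
    have "continuous_on {0..t + 1} (\<lambda>s. exp (\<mu> * s) * u s)"
      by (intro continuous_intros continuous_on_subset[OF cont]) auto
    then have "(I has_real_derivative exp (\<mu> * t) * u t) (at t within {0..t + 1})"
      unfolding I_def by (rule integral_has_real_derivative) (use that in auto)
    moreover have "at t within {0..t + 1} = at t within {0..}"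
      by (rule at_within_nhd[of _ "{..<t + 1}"]) auto
    ultimately show ?thesis by simp
  qed
  have X: "(X has_real_derivative - \<mu> * X t + u t) (at t within {0..})" if "0 \<le> t" for t
  proof -
    have "(X has_real_derivative
        exp (- \<mu> * t) * (exp (\<mu> * t) * u t) + exp (- \<mu> * t) * - \<mu> * (x0 + I t)) (at t within {0..})"
      unfolding X_def by (rule derivative_eq_intros I that refl | simp)+
    then show ?thesis
      by (simp add: X_def exp_minus field_simps)
  qed
  obtain M where M: "\<And>t. 0 \<le> t \<Longrightarrow> \<bar>u t\<bar> \<le> M"
    using bdd by (auto simp: bounded_iff)
  have M0: "M \<ge> 0" using M[of 0] by simp
  have "\<bar>X t\<bar> \<le> \<bar>X 0\<bar> + M / \<mu>" if "0 \<le> t" for t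
  proof -
    have "X t \<le> \<bar>X 0\<bar> + M / \<mu>"
      by (rule damped_linear_upper_bound[OF X _ \<mu> M0 that]) (use M abs_le_D1 in blast)+
    moreover have "- X t \<le> \<bar>- X 0\<bar> + M / \<mu>"
    proof (rule damped_linear_upper_bound[of "\<lambda>t. - X t" \<mu> "\<lambda>t. - u t", OF _ _ \<mu> M0 that])
      show "((\<lambda>t. - X t) has_real_derivative - \<mu> * - X t + - u t) (at t within {0..})"
        if "0 \<le> t" for t
        using DERIV_minus[OF X[OF that]] by (simp add: algebra_simps)
      show "- u t \<le> M" if "0 \<le> t" for t
        using M[OF that] by linarith
    qed
    ultimately show ?thesis by simp
  qed
  then have "bounded (X ` {0..})" by (auto simp: bounded_iff)
  moreover have "X 0 = x0" by (simp add: X_def I_def)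
  ultimately show ?thesis using X by blast
qed

text \<open>
  The function \<open>- exp (- m t) u t\<close> is a primitive of \<open>k exp (- m t) P t\<close>, and it tends to \<open>0\<close> when \<open>u\<close>
  is bounded. Dominated convergence, with a multiple of \<open>exp (- m t)\<close> as the majorant, passes from the
  intervals \<open>{0..n}\<close> to the half-line.
\<close>

lemma discounted_integral:
  fixes u P :: "real \<Rightarrow> real"
  assumes u: "\<And>t. 0 \<le> t \<Longrightarrow> (u has_real_derivative m * u t - k * P t) (at t within {0..})"
    and bdd: "bounded (u ` {0..})" "bounded (P ` {0..})" and m: "m > 0"
  shows "u 0 = k * integral {0..} (\<lambda>t. exp (- m * t) * P t)"
proof -
  obtain Mu where Mu: "\<And>t. 0 \<le> t \<Longrightarrow> \<bar>u t\<bar> \<le> Mu" 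
    using bdd(1) by (auto simp: bounded_iff)
  obtain M where M: "\<And>t. 0 \<le> t \<Longrightarrow> \<bar>P t\<bar> \<le> M"
    using bdd(2) by (auto simp: bounded_iff)
  define g where "g = (\<lambda>t. k * (exp (- m * t) * P t))"
  define y where "y = (\<lambda>n::nat. u 0 - exp (- m * real n) * u (real n))"
  have "(g has_integral u 0) {0..}"
  proof (rule has_integral_dominated_convergence)
    show "((\<lambda>x. if x \<in> {0..real n} then g x else 0) has_integral y n) {0..}" for n
    proof -
      have "((\<lambda>t. - (exp (- m * t) * u t)) has_vector_derivative g t) (at t within {0..real n})"
        if "t \<in> {0..real n}" for t
      proof -
        have "((\<lambda>t. - (exp (- m * t) * u t)) has_real_derivative g t) (at t within {0..})"
          unfolding g_def
          by (rule derivative_eq_intros u refl | use that in \<open>simp add: algebra_simps\<close>)+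
        then show ?thesis
          unfolding has_real_derivative_iff_has_vector_derivative
          by (rule has_vector_derivative_within_subset) auto
      qed
      then have "(g has_integral y n) {0..real n}"
        using fundamental_theorem_of_calculus[of 0 "real n" "\<lambda>t. - (exp (- m * t) * u t)" g]
        by (simp add: y_def)
      then show ?thesis
        by (subst has_integral_restrict) auto
    qed
    show "(\<lambda>t. \<bar>k\<bar> * M * exp (- m * t)) integrable_on {0..}"
      using has_integral_mult_right[OF has_integral_exp_minus_to_infinity[OF m, of 0]]
      unfolding integrable_on_def by blast
    show "\<forall>x\<in>{0..}. norm (if x \<in> {0..real n} then g x else 0) \<le> \<bar>k\<bar> * M * exp (- m * x)" for n
    proof
      fix x :: real assume "x \<in> {0..}"
      then have "\<bar>P x\<bar> \<le> M" "0 \<le> M" using M[of x] by auto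
      then have "\<bar>k\<bar> * exp (- m * x) * \<bar>P x\<bar> \<le> \<bar>k\<bar> * exp (- m * x) * M"
        by (intro mult_left_mono) auto
      then show "norm (if x \<in> {0..real n} then g x else 0) \<le> \<bar>k\<bar> * M * exp (- m * x)"
        using \<open>0 \<le> M\<close> by (simp add: g_def abs_mult mult_ac)
    qed
    show "\<forall>x\<in>{0..}. (\<lambda>n. if x \<in> {0..real n} then g x else 0) \<longlonglongrightarrow> g x"
    proof
      fix x :: real assume "x \<in> {0..}"
      then have "eventually (\<lambda>n. g x = (if x \<in> {0..real n} then g x else 0)) sequentially"
        by (intro eventually_mono[OF eventually_ge_at_top[of "nat \<lceil>x\<rceil>"]])
          (auto simp: ceiling_le_iff nat_le_iff)
      then show "(\<lambda>n. if x \<in> {0..real n} then g x else 0) \<longlonglongrightarrow> g x"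
        by (rule Lim_transform_eventually[OF tendsto_const])
    qed
    show "y \<longlonglongrightarrow> u 0"
    proof -
      have e: "(\<lambda>n. exp (- m * real n) * Mu) \<longlonglongrightarrow> 0"
      proof -
        have "filterlim (\<lambda>n. - m * real n) at_bot sequentially"
          using m by (intro filterlim_tendsto_neg_mult_at_bot[OF tendsto_const] filterlim_real_sequentially) auto
        then show ?thesis
          by (intro tendsto_mult_left_zero filterlim_compose[OF exp_at_bot])
      qed
      have "(\<lambda>n. exp (- m * real n) * u (real n)) \<longlonglongrightarrow> 0"
        by (rule Lim_null_comparison[OF _ e]) (auto intro!: always_eventually simp: abs_mult Mu)
      from tendsto_diff[OF tendsto_const this, of "u 0"] show ?thesis by (simp add: y_def)
    qed
  qed
  then have "integral {0..} g = u 0" by (rule integral_unique)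
  then show ?thesis by (simp add: g_def)
qed

section \<open>The damped oscillator\<close>

text \<open>
  The equation \<open>y'' = s y' - d y\<close> as a first-order system. The velocity \<open>V\<close> is a parameter because its
  value at \<open>0\<close> is a one-sided derivative, and because it occurs in the energy and in the initial data.
\<close>

definition oscillator :: "real \<Rightarrow> real \<Rightarrow> (real \<Rightarrow> real) \<Rightarrow> (real \<Rightarrow> real) \<Rightarrow> bool" where
  "oscillator s d Y V \<longleftrightarrow>
     (\<forall>t\<ge>0. (Y has_real_derivative V t) (at t within {0..})) \<and>
     (\<forall>t\<ge>0. (V has_real_derivative s * V t - d * Y t) (at t within {0..}))"

text \<open>
  The energy dissipates at the rate \<open>2 s V\<^sup>2\<close>: the terms \<open>2 d Y V\<close> cancel.
\<close>

lemma oscillator_energy: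
  assumes osc: "oscillator s d Y V" and "s \<le> 0" and t: "0 \<le> t"
  shows "d * (Y t)\<^sup>2 + (V t)\<^sup>2 \<le> d * (Y 0)\<^sup>2 + (V 0)\<^sup>2"
proof (rule halfline_nonincreasing[OF _ _ t])
  show "((\<lambda>t. d * (Y t)\<^sup>2 + (V t)\<^sup>2) has_real_derivative 2 * s * (V t)\<^sup>2) (at t within {0..})"
    if "0 \<le> t" for t
    using osc that unfolding oscillator_def
    by (auto intro!: derivative_eq_intros simp: power2_eq_square algebra_simps)
  show "2 * s * (V t)\<^sup>2 \<le> 0" for t
    using \<open>s \<le> 0\<close> by (auto intro: mult_nonpos_nonneg)
qed

lemma oscillator_bounded:
  assumes osc: "oscillator s d Y V" and "s \<le> 0" "d > 0"
  shows "bounded (Y ` {0..})" "bounded (V ` {0..})"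
proof -
  define E where "E = d * (Y 0)\<^sup>2 + (V 0)\<^sup>2"
  have E: "d * (Y t)\<^sup>2 + (V t)\<^sup>2 \<le> E" if "0 \<le> t" for t
    unfolding E_def by (rule oscillator_energy[OF osc \<open>s \<le> 0\<close> that])
  have "\<bar>Y t\<bar> \<le> sqrt (E / d)" if "0 \<le> t" for t
  proof (rule real_le_rsqrt)
    have "d * (Y t)\<^sup>2 \<le> E" using E[OF that] zero_le_power2[of "V t"] by linarith
    then show "\<bar>Y t\<bar>\<^sup>2 \<le> E / d" using \<open>d > 0\<close> by (simp add: field_simps)
  qed
  then show "bounded (Y ` {0..})" by (auto simp: bounded_iff)
  have "\<bar>V t\<bar> \<le> sqrt E" if "0 \<le> t" for t
  proof (rule real_le_rsqrt)
    have "0 \<le> d * (Y t)\<^sup>2" using \<open>d > 0\<close> by simp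
    then show "\<bar>V t\<bar>\<^sup>2 \<le> E" using E[OF that] by simp
  qed
  then show "bounded (V ` {0..})" by (auto simp: bounded_iff)
qed

lemma oscillator_unique:
  assumes Y: "oscillator s d Y V" and Z: "oscillator s d Z W"
    and init: "Y 0 = Z 0" "V 0 = W 0" and "s \<le> 0" "d > 0" and t: "0 \<le> t"
  shows "Y t = Z t"
proof -
  have "oscillator s d (\<lambda>t. Y t - Z t) (\<lambda>t. V t - W t)"
    using Y Z unfolding oscillator_def
    by (auto intro!: derivative_eq_intros simp: algebra_simps)
  from oscillator_energy[OF this \<open>s \<le> 0\<close> t] have "d * (Y t - Z t)\<^sup>2 + (V t - W t)\<^sup>2 \<le> 0"
    using init by simp
  moreover have "0 \<le> (V t - W t)\<^sup>2" "0 \<le> d * (Y t - Z t)\<^sup>2" using \<open>d > 0\<close> by auto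
  ultimately have "d * (Y t - Z t)\<^sup>2 = 0" by linarith
  then show ?thesis using \<open>d > 0\<close> by simp
qed

text \<open>
  Here \<open>s\<close> and \<open>d\<close> are written as the sum and the product of the roots of the characteristic polynomial
  \<open>K\<^sup>2 - s K + d\<close>; the same is done below for a double root \<open>K\<close> and for a conjugate pair with real part
  \<open>KR\<close> and imaginary parts \<open>KI\<close>, \<open>- KI\<close>.
\<close>

lemma oscillator_distinct_real:
  fixes K1 K2 y0 q :: real
  assumes "K1 \<noteq> K2"
  defines "Y \<equiv> \<lambda>t. (- q + y0 * K2) / (K2 - K1) * exp (K1 * t) + (q - y0 * K1) / (K2 - K1) * exp (K2 * t)"
  shows "\<exists>V. oscillator (K1 + K2) (K1 * K2) Y V \<and> Y 0 = y0 \<and> V 0 = q"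
proof -
  define a b where "a = (- q + y0 * K2) / (K2 - K1)" and "b = (q - y0 * K1) / (K2 - K1)"
  define V where "V = (\<lambda>t. a * K1 * exp (K1 * t) + b * K2 * exp (K2 * t))"
  have "oscillator (K1 + K2) (K1 * K2) Y V"
    unfolding oscillator_def Y_def V_def a_def[symmetric] b_def[symmetric]
    by (auto intro!: derivative_eq_intros simp: algebra_simps)
  moreover have "a + b = y0" "a * K1 + b * K2 = q"
  proof -
    have "K2 - K1 \<noteq> 0" using assms(1) by simp
    moreover have "a + b = (K2 - K1) * y0 / (K2 - K1)" "a * K1 + b * K2 = (K2 - K1) * q / (K2 - K1)"
      unfolding a_def b_def times_divide_eq_left add_divide_distrib[symmetric]
      by (simp_all add: algebra_simps)
    ultimately show "a + b = y0" "a * K1 + b * K2 = q" by simp_all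
  qed
  moreover have "Y 0 = a + b" by (simp add: Y_def a_def b_def)
  moreover have "V 0 = a * K1 + b * K2" by (simp add: V_def)
  ultimately show ?thesis by metis
qed

lemma oscillator_double_real:
  fixes K y0 q :: real
  defines "Y \<equiv> \<lambda>t. exp (K * t) * (y0 + (q - K * y0) * t)"
  shows "\<exists>V. oscillator (2 * K) (K\<^sup>2) Y V \<and> Y 0 = y0 \<and> V 0 = q"
proof -
  define V where "V = (\<lambda>t. exp (K * t) * (q + K * (q - K * y0) * t))"
  have "oscillator (2 * K) (K\<^sup>2) Y V"
    unfolding oscillator_def Y_def V_def
    by (auto intro!: derivative_eq_intros simp: algebra_simps power2_eq_square)
  moreover have "Y 0 = y0" "V 0 = q" by (simp_all add: Y_def V_def)
  ultimately show ?thesis by blast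
qed

lemma oscillator_complex:
  fixes KR KI y0 q :: real
  assumes "KI \<noteq> 0"
  defines "Y \<equiv> \<lambda>t. exp (KR * t) * (y0 * cos (KI * t) + (q - y0 * KR) / KI * sin (KI * t))"
  shows "\<exists>V. oscillator (2 * KR) (KR\<^sup>2 + KI\<^sup>2) Y V \<and> Y 0 = y0 \<and> V 0 = q"
proof -
  define b where "b = (q - y0 * KR) / KI"
  define V where "V = (\<lambda>t. exp (KR * t) *
    ((KR * y0 + KI * b) * cos (KI * t) + (KR * b - KI * y0) * sin (KI * t)))"
  have "oscillator (2 * KR) (KR\<^sup>2 + KI\<^sup>2) Y V"
    unfolding oscillator_def Y_def V_def b_def[symmetric]
    by (auto intro!: derivative_eq_intros simp: algebra_simps power2_eq_square)
  moreover have "V 0 = q"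
    using assms(1) by (simp add: V_def b_def)
  moreover have "Y 0 = y0"
    by (simp add: Y_def)
  ultimately show ?thesis by blast
qed

lemma oscillator_exists:
  obtains Y V where "oscillator s d Y V" "Y 0 = y0" "V 0 = q"
proof -
  define \<delta> where "\<delta> = s\<^sup>2 / 4 - d"
  consider "\<delta> > 0" | "\<delta> = 0" | "\<delta> < 0" by linarith
  then have "\<exists>Y V. oscillator s d Y V \<and> Y 0 = y0 \<and> V 0 = q"
  proof cases
    case 1
    define K1 K2 where "K1 = s / 2 - sqrt \<delta>" and "K2 = s / 2 + sqrt \<delta>"
    have "K1 * K2 = (s / 2)\<^sup>2 - (sqrt \<delta>)\<^sup>2"
      by (simp add: K1_def K2_def power2_eq_square algebra_simps)
    then have eqs: "K1 + K2 = s" "K1 * K2 = d" and "K1 \<noteq> K2"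
      using 1 by (simp_all add: K1_def K2_def \<delta>_def power_divide)
    from this(3) show ?thesis
      using oscillator_distinct_real[of K1 K2 q y0] unfolding eqs by blast
  next
    case 2
    then have eqs: "2 * (s / 2) = s" "(s / 2)\<^sup>2 = d" by (simp_all add: \<delta>_def power_divide)
    show ?thesis using oscillator_double_real[of "s / 2" y0 q] unfolding eqs by blast
  next
    case 3
    then have eqs: "2 * (s / 2) = s" "(s / 2)\<^sup>2 + (sqrt (- \<delta>))\<^sup>2 = d" and "sqrt (- \<delta>) \<noteq> 0"
      by (simp_all add: \<delta>_def power_divide)
    from this(3) show ?thesis
      using oscillator_complex[of "sqrt (- \<delta>)" "s / 2" y0 q] unfolding eqs by blast
  qed
  then show ?thesis using that by blast
qed

section \<open>The characteristic cubic\<close>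

text \<open>
  The last three assumptions say that
  \<open>K\<^sup>3 + (\<alpha> - \<rho>) K\<^sup>2 - A K - B = (K - \<kappa>) (K\<^sup>2 - s K + d)\<close> identically; the first one says
  that \<open>\<kappa>\<close> is unstable and the two roots of the quadratic factor are stable.
\<close>

locale factored_cubic =
  fixes \<alpha> \<rho> A B \<kappa> s d :: real
  assumes signs: "\<kappa> > 0" "s < 0" "d > 0"
    and root_sum: "s + \<kappa> = \<rho> - \<alpha>"
    and root_pairs: "d + s * \<kappa> = - A"
    and root_prod: "d * \<kappa> = B"

text \<open>
  The number \<open>e\<close> is the product \<open>\<eta> k\<close>. The cubic equals
  \<open>(K + \<alpha>) (K + \<mu>) (K - (\<mu> + \<rho>)) - \<alpha> e\<close>, so it is nonpositive at \<open>\<mu> + \<rho>\<close>, and it is nonnegative at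
  \<open>\<mu> + \<rho> + e / \<mu>\<close>, where the first two factors are at least \<open>\<alpha>\<close> and \<open>\<mu>\<close>. A root \<open>\<kappa> \<ge> \<mu> + \<rho>\<close> between them
  leaves \<open>s = \<rho> - \<alpha> - \<kappa> \<le> - \<alpha> - \<mu> < 0\<close>.
\<close>

lemma cubic_factorization:
  fixes \<alpha> \<rho> \<mu> e :: real
  assumes pos: "\<alpha> > 0" "\<rho> > 0" "\<mu> > 0" and e: "e \<ge> 0"
  defines "A \<equiv> coeff_A \<alpha> \<rho> \<mu>" and "B \<equiv> \<alpha> * (\<mu> * (\<mu> + \<rho>) + e)"
  obtains \<kappa> s d where "factored_cubic \<alpha> \<rho> A B \<kappa> s d"
proof -
  define g where "g = (\<lambda>K. (K + \<alpha>) * (K + \<mu>) * (K - (\<mu> + \<rho>)) - \<alpha> * e)"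
  have g_cubic: "g K = K^3 + (\<alpha> - \<rho>) * K\<^sup>2 - A * K - B" for K
    by (simp add: g_def A_def B_def coeff_A_def power2_eq_square power3_eq_cube algebra_simps)
  have "g (\<mu> + \<rho>) \<le> 0" using pos e by (simp add: g_def)
  moreover have "0 \<le> g (\<mu> + \<rho> + e / \<mu>)"
  proof -
    define K where "K = \<mu> + \<rho> + e / \<mu>"
    have "\<alpha> * e = \<alpha> * \<mu> * (e / \<mu>)" using pos by simp
    also have "\<dots> \<le> (K + \<alpha>) * (K + \<mu>) * (e / \<mu>)"
      using pos e by (intro mult_right_mono mult_mono) (auto simp: K_def)
    finally show ?thesis by (simp add: g_def K_def)
  qed
  moreover have "continuous_on {\<mu> + \<rho>..\<mu> + \<rho> + e / \<mu>} g"
    unfolding g_def by (intro continuous_intros)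
  moreover have "\<mu> + \<rho> \<le> \<mu> + \<rho> + e / \<mu>" using pos e by simp
  ultimately obtain \<kappa> where \<kappa>: "\<mu> + \<rho> \<le> \<kappa>" "g \<kappa> = 0"
    using IVT'[of g "\<mu> + \<rho>" 0 "\<mu> + \<rho> + e / \<mu>"] by blast
  have B: "B > 0" using pos e by (auto simp: B_def intro!: add_pos_nonneg mult_pos_pos)
  have \<kappa>0: "\<kappa> > 0" using \<kappa> pos by linarith
  show ?thesis
  proof (rule that[of \<kappa> "\<rho> - \<alpha> - \<kappa>" "B / \<kappa>"], unfold_locales)
    have "\<kappa> * (\<kappa>\<^sup>2 + (\<alpha> - \<rho>) * \<kappa> - A) = B"
      using \<kappa>(2) by (simp add: g_cubic power2_eq_square power3_eq_cube algebra_simps)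
    then have "B / \<kappa> = \<kappa>\<^sup>2 + (\<alpha> - \<rho>) * \<kappa> - A" using \<kappa>0 by (simp add: field_simps)
    then show "B / \<kappa> + (\<rho> - \<alpha> - \<kappa>) * \<kappa> = - A"
      by (simp add: power2_eq_square algebra_simps)
  qed (use \<kappa> \<kappa>0 B pos in auto)
qed

context factored_cubic
begin

lemma cubic_roots_iff:
  "K \<in> cubic_roots \<alpha> \<rho> A B \<longleftrightarrow> K = of_real \<kappa> \<or> K\<^sup>2 - of_real s * K + of_real d = 0"
proof -
  have ar: "\<alpha> - \<rho> = - (s + \<kappa>)" and A: "A = - (d + s * \<kappa>)"
    using root_sum root_pairs by auto
  have "K^3 + of_real (\<alpha> - \<rho>) * K\<^sup>2 - of_real A * K - of_real B
      = (K - of_real \<kappa>) * (K\<^sup>2 - of_real s * K + of_real d)"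
    unfolding ar A root_prod[symmetric]
    by (simp add: power2_eq_square power3_eq_cube algebra_simps)
  then have "K \<in> cubic_roots \<alpha> \<rho> A B \<longleftrightarrow>
      (K - of_real \<kappa>) * (K\<^sup>2 - of_real s * K + of_real d) = 0"
    unfolding cubic_roots_def mem_Collect_eq by (simp only:)
  then show ?thesis by simp
qed

text \<open>
  The discriminant of the cubic is the discriminant of the quadratic factor times the squared value of
  that factor at \<open>\<kappa>\<close>, and this value is positive as \<open>\<kappa> > 0\<close> and \<open>s < 0 < d\<close>.
\<close>

lemma discr_sign: "sgn (cubic_discr \<alpha> \<rho> A B) = sgn (s\<^sup>2 - 4 * d)"
proof -
  have ar: "\<alpha> - \<rho> = - (s + \<kappa>)" and A: "A = - (d + s * \<kappa>)"
    using root_sum root_pairs by auto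
  have "cubic_discr \<alpha> \<rho> A B = (s\<^sup>2 - 4 * d) * (\<kappa>\<^sup>2 - s * \<kappa> + d)\<^sup>2"
    unfolding cubic_discr_def ar A root_prod[symmetric] by algebra
  moreover have "\<kappa>\<^sup>2 - s * \<kappa> + d > 0"
  proof -
    have "s * \<kappa> < 0" using signs by (simp add: mult_neg_pos)
    then show ?thesis using signs zero_le_power2[of \<kappa>] by linarith
  qed
  ultimately show ?thesis by (simp add: sgn_mult)
qed

lemma discr_pos_roots:
  assumes "s\<^sup>2 > 4 * d"
  shows "\<exists>K1 K2. cubic_roots \<alpha> \<rho> A B = {of_real K1, of_real K2, of_real \<kappa>} \<and> K1 < K2 \<and> K2 < 0"
proof -
  define e where "e = sqrt (s\<^sup>2 - 4 * d)"
  define K1 K2 where "K1 = (s - e) / 2" and "K2 = (s + e) / 2"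
  have e: "e > 0" "e\<^sup>2 = s\<^sup>2 - 4 * d" using assms by (simp_all add: e_def)
  have "e\<^sup>2 < (- s)\<^sup>2" using e signs by simp
  then have "e < - s" by (rule power2_less_imp_less) (use signs in simp)
  then have ord: "K1 < K2" "K2 < 0" using e by (simp_all add: K1_def K2_def)
  have sum: "s = K1 + K2" by (simp add: K1_def K2_def field_simps)
  have "K1 * K2 = (s\<^sup>2 - e\<^sup>2) / 4"
    by (simp add: K1_def K2_def power2_eq_square field_simps)
  then have prod: "d = K1 * K2" unfolding e(2) by simp
  have "K\<^sup>2 - of_real s * K + of_real d = (K - of_real K1) * (K - of_real K2)" for K :: complex
    unfolding sum prod by (simp add: power2_eq_square algebra_simps)
  then have "K \<in> cubic_roots \<alpha> \<rho> A B \<longleftrightarrow> K = of_real \<kappa> \<or> K = of_real K1 \<or> K = of_real K2" for K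
    unfolding cubic_roots_iff by simp
  then have "cubic_roots \<alpha> \<rho> A B = {of_real K1, of_real K2, of_real \<kappa>}"
    by blast
  then show ?thesis using ord by blast
qed

lemma discr_zero_roots:
  assumes "s\<^sup>2 = 4 * d"
  shows "cubic_roots \<alpha> \<rho> A B = {of_real (s / 2), of_real \<kappa>}"
proof -
  have d: "d = (s / 2)\<^sup>2" using assms by (simp add: power_divide)
  have "K\<^sup>2 - of_real s * K + of_real d = (K - of_real (s / 2))\<^sup>2" for K :: complex
    unfolding d by (simp add: power2_eq_square algebra_simps)
  then have "K \<in> cubic_roots \<alpha> \<rho> A B \<longleftrightarrow> K = of_real \<kappa> \<or> K = of_real (s / 2)" for K
    unfolding cubic_roots_iff by simp
  then show ?thesis by blast
qed

lemma discr_neg_roots: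
  assumes "s\<^sup>2 < 4 * d"
  shows "\<exists>KR KI. cubic_roots \<alpha> \<rho> A B = {Complex KR KI, Complex KR (- KI), of_real \<kappa>} \<and>
    KR < 0 \<and> KI \<noteq> 0"
proof -
  define KR KI where "KR = s / 2" and "KI = sqrt (4 * d - s\<^sup>2) / 2"
  have "(sqrt (4 * d - s\<^sup>2))\<^sup>2 = 4 * d - s\<^sup>2" using assms by simp
  then have d: "d = KR\<^sup>2 + KI\<^sup>2" by (simp add: KR_def KI_def power_divide diff_divide_distrib)
  have s: "s = 2 * KR" by (simp add: KR_def)
  have "K\<^sup>2 - of_real s * K + of_real d = (K - Complex KR KI) * (K - Complex KR (- KI))" for K
    unfolding s d by (simp add: complex_eq_iff power2_eq_square algebra_simps)
  then have "K \<in> cubic_roots \<alpha> \<rho> A B \<longleftrightarrow> K = of_real \<kappa> \<or> K = Complex KR KI \<or> K = Complex KR (- KI)" for K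
    unfolding cubic_roots_iff by simp
  then have "cubic_roots \<alpha> \<rho> A B = {Complex KR KI, Complex KR (- KI), of_real \<kappa>}"
    by blast
  moreover have "KR < 0" "KI \<noteq> 0" using signs assms by (simp_all add: KR_def KI_def)
  ultimately show ?thesis by blast
qed

text \<open>
  A root of the cubic that is negative or not real differs from \<open>\<kappa>\<close>, so it is a root of the quadratic
  factor. This lets \<open>s\<close> and \<open>d\<close> be recovered from any enumeration of the roots with the prescribed signs.
\<close>

lemma negative_root:
  assumes "of_real K \<in> cubic_roots \<alpha> \<rho> A B" "K < 0"
  shows "K\<^sup>2 - s * K + d = 0"
proof -
  have "of_real (K\<^sup>2 - s * K + d) = (0 :: complex)"
    using assms signs by (simp add: cubic_roots_iff)
  then show ?thesis by (simp only: of_real_eq_0_iff)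
qed

lemma vieta_two_negative:
  assumes "of_real K1 \<in> cubic_roots \<alpha> \<rho> A B" "of_real K2 \<in> cubic_roots \<alpha> \<rho> A B"
    and "K1 < K2" "K2 < 0"
  shows "K1 + K2 = s" "K1 * K2 = d"
proof -
  have eq: "K1\<^sup>2 - s * K1 + d = 0" "K2\<^sup>2 - s * K2 + d = 0"
    using assms by (auto intro: negative_root)
  then have "(K2 - K1) * (K1 + K2 - s) = 0" by (simp add: power2_eq_square algebra_simps)
  then show sum: "K1 + K2 = s" using assms by simp
  show "K1 * K2 = d" using eq(1) unfolding sum[symmetric] by (simp add: power2_eq_square algebra_simps)
qed

lemma vieta_double_negative:
  assumes "of_real K \<in> cubic_roots \<alpha> \<rho> A B" "K < 0" "s\<^sup>2 = 4 * d"
  shows "2 * K = s" "K\<^sup>2 = d"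
proof -
  have "K\<^sup>2 - s * K + d = 0" using assms by (auto intro: negative_root)
  then have "(2 * K - s)\<^sup>2 = 0" using assms(3) by (simp add: power2_eq_square algebra_simps)
  then show K: "2 * K = s" by simp
  show "K\<^sup>2 = d" using assms(3) unfolding K[symmetric] by (simp add: power_mult_distrib)
qed

lemma vieta_complex:
  assumes "Complex KR KI \<in> cubic_roots \<alpha> \<rho> A B" "KI \<noteq> 0"
  shows "2 * KR = s" "KR\<^sup>2 + KI\<^sup>2 = d"
proof -
  have "Complex KR KI \<noteq> of_real \<kappa>" using assms(2) by (simp add: complex_eq_iff)
  then have "(Complex KR KI)\<^sup>2 - of_real s * Complex KR KI + of_real d = 0"
    using assms(1) by (simp add: cubic_roots_iff)
  then have re: "KR\<^sup>2 - KI\<^sup>2 - s * KR + d = 0" and im: "(2 * KR - s) * KI = 0"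
    by (auto simp: complex_eq_iff power2_eq_square algebra_simps)
  show s: "2 * KR = s" using im assms(2) by simp
  show "KR\<^sup>2 + KI\<^sup>2 = d" using re unfolding s[symmetric] by (simp add: power2_eq_square)
qed

end

section \<open>Bounded mean-field flows\<close>

lemma bounded_const_image: "bounded ((\<lambda>x. c :: real) ` S)"
  by (simp add: image_constant_conv)

lemma bounded_scaled_image: "bounded (f ` S) \<Longrightarrow> bounded ((\<lambda>x. c * f x) ` S)"
  for f :: "'a \<Rightarrow> real"
  using bounded_scaleR_comp[of f S c] by simp
text \<open>
  The differential equations of the mean-field system with the parameters \<open>\<eta> = 1 - lam \<gamma>\<close> and
  \<open>k = (1 - c) / (2 r)\<close>, and boundedness in place of the integral condition on \<open>u 0\<close>.
\<close>

definition bounded_flow ::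
  "real \<Rightarrow> real \<Rightarrow> real \<Rightarrow> real \<Rightarrow> real \<Rightarrow> real \<Rightarrow> (real \<Rightarrow> real) \<Rightarrow> (real \<Rightarrow> real) \<Rightarrow> (real \<Rightarrow> real) \<Rightarrow> bool"
  where
  "bounded_flow \<alpha> \<beta> \<rho> \<mu> \<eta> k P X u \<longleftrightarrow>
     (\<forall>t\<ge>0. (P has_real_derivative \<alpha> * (\<beta> - \<eta> * X t - P t)) (at t within {0..})) \<and>
     (\<forall>t\<ge>0. (X has_real_derivative - \<mu> * X t + u t) (at t within {0..})) \<and>
     (\<forall>t\<ge>0. (u has_real_derivative (\<mu> + \<rho>) * u t - k * P t) (at t within {0..})) \<and>
     bounded (P ` {0..}) \<and> bounded (X ` {0..}) \<and> bounded (u ` {0..})"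

locale factored_mean_field = factored_cubic \<alpha> \<rho> A B \<kappa> s d
  for \<alpha> \<rho> A B \<kappa> s d :: real +
  fixes \<beta> \<mu> \<eta> k ps :: real
  assumes pos: "\<alpha> > 0" "\<rho> > 0" "\<mu> > 0"
    and A_eq: "A = coeff_A \<alpha> \<rho> \<mu>"
    and B_eq: "B = \<alpha> * (\<mu> * (\<mu> + \<rho>) + \<eta> * k)"
    and equilibrium: "ps * B = \<alpha> * \<mu> * \<beta> * (\<mu> + \<rho>)"
begin

text \<open>
  The cubic, applied to the time derivative, annihilates \<open>P - ps\<close>. Applying only its quadratic factor
  yields a function \<open>w\<close> with \<open>w' = \<kappa> w\<close>. Expressed through \<open>P\<close>, \<open>X\<close> and \<open>u\<close> it is bounded, hence zero.
\<close>

lemma bounded_flow_oscillator: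
  assumes flow: "bounded_flow \<alpha> \<beta> \<rho> \<mu> \<eta> k P X u"
  shows "oscillator s d (\<lambda>t. P t - ps) (\<lambda>t. \<alpha> * (\<beta> - \<eta> * X t - P t))"
proof -
  define Q where "Q = (\<lambda>t. \<alpha> * (\<beta> - \<eta> * X t - P t))"
  define Q' where "Q' = (\<lambda>t. \<alpha> * (- \<eta> * (- \<mu> * X t + u t) - Q t))"
  define w where "w = (\<lambda>t. Q' t - s * Q t + d * (P t - ps))"
  have P: "(P has_real_derivative Q t) (at t within {0..})"
    and X: "(X has_real_derivative - \<mu> * X t + u t) (at t within {0..})"
    and u: "(u has_real_derivative (\<mu> + \<rho>) * u t - k * P t) (at t within {0..})" if "0 \<le> t" for t
    using flow that by (simp_all add: bounded_flow_def Q_def)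
  have Q: "(Q has_real_derivative Q' t) (at t within {0..})" if "0 \<le> t" for t
    unfolding Q_def[abs_def] Q'_def
    by (rule derivative_eq_intros P X refl | use that in \<open>simp add: Q_def algebra_simps\<close>)+
  have w: "(w has_real_derivative \<kappa> * w t) (at t within {0..})" if "0 \<le> t" for t
  proof -
    define Q'' where "Q'' = \<alpha> * (- \<eta> * (- \<mu> * (- \<mu> * X t + u t) + ((\<mu> + \<rho>) * u t - k * P t)) - Q' t)"
    have "(w has_real_derivative Q'' - s * Q' t + d * Q t) (at t within {0..})"
      unfolding w_def Q'_def[abs_def]
      by (rule derivative_eq_intros P X u Q refl | use that in \<open>simp add: Q''_def Q'_def algebra_simps\<close>)+
    moreover have "Q'' - s * Q' t + d * Q t = \<kappa> * w t"
    proof -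
      have "Q'' - (\<rho> - \<alpha>) * Q' t - coeff_A \<alpha> \<rho> \<mu> * Q t - B * P t
          + \<alpha> * \<mu> * \<beta> * (\<mu> + \<rho>) = 0"
        by (simp add: Q''_def Q'_def Q_def coeff_A_def B_eq power2_eq_square algebra_simps)
      then have "Q'' - (s + \<kappa>) * Q' t + (d + s * \<kappa>) * Q t - d * \<kappa> * P t + ps * B = 0"
        unfolding equilibrium unfolding root_sum root_pairs root_prod A_eq by simp
      then show ?thesis by (simp add: w_def root_prod[symmetric] algebra_simps)
    qed
    ultimately show ?thesis by simp
  qed
  have bdd: "bounded (P ` {0..})" "bounded (X ` {0..})" "bounded (u ` {0..})"
    using flow by (auto simp: bounded_flow_def)
  have "bounded (w ` {0..})"
    unfolding w_def Q'_def Q_def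
    by (intro bounded_plus_comp bounded_minus_comp bounded_scaled_image bdd bounded_const_image)
  then have "w t = 0" if "0 \<le> t" for t
    using bounded_growing_mode_vanishes[of w \<kappa> t] w signs that by blast
  then have "Q' t = s * Q t - d * (P t - ps)" if "0 \<le> t" for t
    using that by (fastforce simp: w_def)
  then show ?thesis
    unfolding oscillator_def Q_def[symmetric]
    using P Q by (auto intro!: derivative_eq_intros)
qed

lemma bounded_flow_price:
  assumes flow: "bounded_flow \<alpha> \<beta> \<rho> \<mu> \<eta> k P X u"
    and Y: "oscillator s d Y V" "Y 0 = P 0 - ps" "V 0 = \<alpha> * (\<beta> - \<eta> * X 0 - P 0)"
    and t: "0 \<le> t"
  shows "P t = ps + Y t"
  using oscillator_unique[OF bounded_flow_oscillator[OF flow] Y(1) _ _ _ _ t] Y signs by simp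

text \<open>
  Once the prices agree, the difference of the components \<open>u\<close> grows like \<open>exp ((\<mu> + \<rho>) t)\<close> and is bounded,
  hence zero; then the difference of the components \<open>X\<close> solves a homogeneous equation. The price alone
  does not determine \<open>X\<close> if \<open>\<eta> = 0\<close>, so \<open>X\<close> is not recovered from the price equation.
\<close>

lemma bounded_flow_unique:
  assumes flow: "bounded_flow \<alpha> \<beta> \<rho> \<mu> \<eta> k P X u" and flow': "bounded_flow \<alpha> \<beta> \<rho> \<mu> \<eta> k P' X' u'"
    and init: "P 0 = P' 0" "X 0 = X' 0" and t: "0 \<le> t"
  shows "P t = P' t" "X t = X' t" "u t = u' t"
proof -
  have P: "P t = P' t" if "0 \<le> t" for t
    using bounded_flow_price[OF flow bounded_flow_oscillator[OF flow'] _ _ that] init by simp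
  have u: "u t - u' t = 0" if "0 \<le> t" for t
  proof (rule bounded_growing_mode_vanishes[OF _ _ _ that])
    show "((\<lambda>t. u t - u' t) has_real_derivative (\<mu> + \<rho>) * (u t - u' t)) (at t within {0..})"
      if "0 \<le> t" for t
      using flow flow' that P[OF that] unfolding bounded_flow_def
      by (auto intro!: derivative_eq_intros simp: algebra_simps)
    show "bounded ((\<lambda>t. u t - u' t) ` {0..})"
      using flow flow' by (auto simp: bounded_flow_def intro!: bounded_minus_comp)
  qed (use pos in simp)
  have "X t - X' t = (X 0 - X' 0) * exp (- \<mu> * t)"
  proof (rule exponential_solution[OF _ t])
    show "((\<lambda>t. X t - X' t) has_real_derivative - \<mu> * (X t - X' t)) (at t within {0..})"
      if "0 \<le> t" for t
      using flow flow' that u[OF that] unfolding bounded_flow_def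
      by (auto intro!: derivative_eq_intros simp: algebra_simps)
  qed
  then show "X t = X' t" using init by simp
  show "P t = P' t" "u t = u' t" using P u t by auto
qed

text \<open>
  The oscillator \<open>Y\<close> provides the price \<open>ps + Y\<close>, and \<open>u\<close> is the bounded solution of
  \<open>u' = m u - k P\<close>, found with undetermined coefficients. Solving the price equation for \<open>X\<close> would
  divide by \<open>\<eta>\<close>, which may be \<open>0\<close>; instead \<open>X\<close> solves its own equation, and the defect \<open>v\<close> of
  the price equation is shown to vanish, from \<open>v' = - \<mu> v\<close> and \<open>v 0 = 0\<close>.
\<close>

lemma bounded_flow_exists:
  obtains P X u where "bounded_flow \<alpha> \<beta> \<rho> \<mu> \<eta> k P X u" "P 0 = p0" "X 0 = x0"
proof -
  define m where "m = \<mu> + \<rho>"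
  define h where "h = m\<^sup>2 - s * m + d"
  have m: "m > 0" using pos by (simp add: m_def)
  have "s * m < 0" using m signs by (simp add: mult_neg_pos)
  then have h: "h > 0" using signs zero_le_power2[of m] unfolding h_def by linarith
  obtain Y V where Y: "oscillator s d Y V"
    and init: "Y 0 = p0 - ps" "V 0 = \<alpha> * (\<beta> - \<eta> * x0 - p0)"
    by (rule oscillator_exists)
  have dY: "(Y has_real_derivative V t) (at t within {0..})"
    and dV: "(V has_real_derivative s * V t - d * Y t) (at t within {0..})" if "0 \<le> t" for t
    using Y that by (auto simp: oscillator_def)
  have bY: "bounded (Y ` {0..})" "bounded (V ` {0..})"
    using oscillator_bounded[OF Y] signs by auto
  \<comment> \<open>\<open>h\<close> is the quadratic factor at \<open>m\<close>; these values make \<open>a Y + b V\<close> solve \<open>z' = m z - Y\<close>.\<close>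
  define a b where "a = (m - s) / h" and "b = 1 / h"
  have ab: "a + b * s = m * b" "b * d + m * a = 1"
  proof -
    show "a + b * s = m * b" by (simp add: a_def b_def diff_divide_distrib)
    have "b * d + m * a = h / h"
      by (simp add: a_def b_def add_divide_distrib[symmetric] h_def power2_eq_square algebra_simps)
    then show "b * d + m * a = 1" using h by simp
  qed
  define P u where "P = (\<lambda>t. ps + Y t)" and "u = (\<lambda>t. k * (a * Y t + b * V t + ps / m))"
  have du: "(u has_real_derivative m * u t - k * P t) (at t within {0..})" if "0 \<le> t" for t
  proof -
    have "(u has_real_derivative k * (a * V t + b * (s * V t - d * Y t))) (at t within {0..})"
      unfolding u_def
      by (rule derivative_eq_intros dY dV refl | use that in simp)+
    also have "k * (a * V t + b * (s * V t - d * Y t)) = k * ((a + b * s) * V t + (m * a - (b * d + m * a)) * Y t)"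
      by (simp add: algebra_simps)
    also have "\<dots> = m * u t - k * P t"
      unfolding ab u_def P_def using m by (simp add: algebra_simps)
    finally show ?thesis .
  qed
  have bu: "bounded (u ` {0..})"
    unfolding u_def
    by (intro bounded_plus_comp bounded_scaled_image bY bounded_const_image)
  have "continuous_on {0..} u"
    by (rule DERIV_continuous_on, rule du) simp
  from damped_linear_solution_exists[OF this bu, of \<mu> x0] pos
  obtain X where X0: "X 0 = x0" and bX: "bounded (X ` {0..})"
    and dX: "\<And>t. 0 \<le> t \<Longrightarrow> (X has_real_derivative - \<mu> * X t + u t) (at t within {0..})"
    by blast
  define v where "v = (\<lambda>t. V t - \<alpha> * (\<beta> - \<eta> * X t - P t))"
  have v: "(v has_real_derivative - \<mu> * v t) (at t within {0..})" if "0 \<le> t" for t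
  proof -
    have "(v has_real_derivative s * V t - d * Y t + \<alpha> * (\<eta> * (- \<mu> * X t + u t) + V t)) (at t within {0..})"
      unfolding v_def P_def
      by (rule derivative_eq_intros dY dV dX refl | use that in \<open>simp add: algebra_simps\<close>)+
    moreover have "s * V t - d * Y t + \<alpha> * (\<eta> * (- \<mu> * X t + u t) + V t) = - \<mu> * v t"
    proof -
      \<comment> \<open>The cubic has the value \<open>- \<alpha> \<eta> k\<close> at \<open>m = \<mu> + \<rho>\<close>; this rewrites the coefficients of
        \<open>\<alpha> \<eta> u\<close> without division by \<open>\<eta>\<close>.\<close>
      have "(m - \<kappa>) * h = - (\<alpha> * \<eta> * k)"
      proof -
        have "(m - \<kappa>) * h = m^3 - (s + \<kappa>) * m\<^sup>2 + (d + s * \<kappa>) * m - d * \<kappa>"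
          by (simp add: h_def power2_eq_square power3_eq_cube algebra_simps)
        also have "\<dots> = - (\<alpha> * \<eta> * k)"
          unfolding root_sum root_pairs root_prod A_eq B_eq
          by (simp add: m_def coeff_A_def power2_eq_square power3_eq_cube algebra_simps)
        finally show ?thesis .
      qed
      then have \<eta>k: "\<alpha> * \<eta> * k = (\<kappa> - m) * h" by (simp add: algebra_simps)
      have eb: "\<alpha> * \<eta> * k * b = \<kappa> - m" and ea: "\<alpha> * \<eta> * k * a = (\<kappa> - m) * (m - s)"
        unfolding \<eta>k using h by (simp_all add: a_def b_def)
      have ec: "\<alpha> * \<eta> * k * (ps / m) = \<alpha> * \<mu> * (\<beta> - ps)"
        using equilibrium m unfolding B_eq by (simp add: m_def field_simps)
      have "\<alpha> * \<eta> * u t = \<alpha> * \<eta> * k * a * Y t + \<alpha> * \<eta> * k * b * V t + \<alpha> * \<eta> * k * (ps / m)"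
        by (simp add: u_def algebra_simps)
      then have "\<alpha> * \<eta> * u t = (\<kappa> - m) * (m - s) * Y t + (\<kappa> - m) * V t + \<alpha> * \<mu> * (\<beta> - ps)"
        unfolding ea eb ec .
      moreover have "(\<kappa> - m) * (m - s) = d - \<alpha> * \<mu>"
      proof -
        have "(\<kappa> - m) * (m - s) = (s + \<kappa>) * m - m\<^sup>2 - (d + s * \<kappa>) + d"
          by (simp add: power2_eq_square algebra_simps)
        also have "\<dots> = d - \<alpha> * \<mu>"
          unfolding root_sum root_pairs A_eq
          by (simp add: m_def coeff_A_def power2_eq_square algebra_simps)
        finally show ?thesis .
      qed
      moreover have "\<kappa> - m = - (s + \<alpha> + \<mu>)"
        using root_sum by (simp add: m_def)
      ultimately have "\<alpha> * \<eta> * u t = (d - \<alpha> * \<mu>) * Y t - (s + \<alpha> + \<mu>) * V t + \<alpha> * \<mu> * (\<beta> - ps)"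
        by (simp only:)
      then show ?thesis by (simp add: v_def P_def algebra_simps)
    qed
    ultimately show ?thesis by simp
  qed
  have "v t = 0" if "0 \<le> t" for t
    using exponential_solution[of v "- \<mu>" t, OF v that] init X0 by (simp add: v_def P_def)
  then have V: "V t = \<alpha> * (\<beta> - \<eta> * X t - P t)" if "0 \<le> t" for t
    using that by (fastforce simp: v_def)
  have "(P has_real_derivative \<alpha> * (\<beta> - \<eta> * X t - P t)) (at t within {0..})" if "0 \<le> t" for t
    using dY[OF that] V[OF that] unfolding P_def by (auto intro!: derivative_eq_intros)
  moreover have "bounded (P ` {0..})"
    unfolding P_def by (intro bounded_plus_comp bY bounded_const_image)
  ultimately have "bounded_flow \<alpha> \<beta> \<rho> \<mu> \<eta> k P X u"
    using dX du bX bu unfolding bounded_flow_def m_def by blast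
  moreover have "P 0 = p0" using init by (simp add: P_def)
  ultimately show ?thesis using that X0 by blast
qed

end


section \<open>The mean-field system\<close>

text \<open>
  For bounded \<open>P\<close> and \<open>u\<close> the integral formula for \<open>u 0\<close> follows from the equation for \<open>u\<close>, by
  \<open>discounted_integral\<close>.
\<close>

lemma mf_system_iff_bounded_flow:
  assumes Cb: "P \<in> Cb" "X \<in> Cb" "u \<in> Cb" and m: "\<mu> + \<rho> > 0"
  shows "mf_system \<alpha> \<beta> \<rho> \<mu> \<gamma> lam r c p0 x0 P X u \<longleftrightarrow>
    bounded_flow \<alpha> \<beta> \<rho> \<mu> (1 - lam * \<gamma>) ((1 - c) / (2 * r)) P X u \<and> P 0 = p0 \<and> X 0 = x0"
proof -
  have bdd: "bounded (P ` {0..})" "bounded (X ` {0..})" "bounded (u ` {0..})"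
    using Cb by (auto simp: Cb_def)
  have "u 0 = (1 - c) / (2 * r) * integral {0..} (\<lambda>t. exp (- (\<mu> + \<rho>) * t) * P t)"
    if "bounded_flow \<alpha> \<beta> \<rho> \<mu> (1 - lam * \<gamma>) ((1 - c) / (2 * r)) P X u"
    using that discounted_integral[OF _ bdd(3) bdd(1) m] unfolding bounded_flow_def by blast
  then show ?thesis
    using bdd unfolding mf_system_def bounded_flow_def by blast
qed

lemma bounded_flow_restrict:
  assumes flow: "bounded_flow \<alpha> \<beta> \<rho> \<mu> \<eta> k P X u"
  defines "P' \<equiv> restrict P {0..}" and "X' \<equiv> restrict X {0..}" and "u' \<equiv> restrict u {0..}"
  shows "P' \<in> Cb" "X' \<in> Cb" "u' \<in> Cb" "bounded_flow \<alpha> \<beta> \<rho> \<mu> \<eta> k P' X' u'"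
proof -
  have transfer: "(restrict f {0..} has_real_derivative D) (at t within {0..})"
    if "(f has_real_derivative D) (at t within {0..})" "0 \<le> t" for f :: "real \<Rightarrow> real" and D t
    by (rule has_field_derivative_transform_within[OF that(1) zero_less_one]) (use that(2) in auto)
  have Cb: "restrict f {0..} \<in> Cb"
    if "\<And>t. 0 \<le> t \<Longrightarrow> (f has_real_derivative D t) (at t within {0..})" "bounded (f ` {0..})"
    for f D :: "real \<Rightarrow> real"
  proof -
    have "continuous_on {0..} f"
      by (rule DERIV_continuous_on, rule that(1)) simp
    then have "continuous_on {0..} (restrict f {0..})"
      by (rule continuous_on_eq) simp
    then show ?thesis using that(2) by (simp add: Cb_def)
  qed
  show flow': "bounded_flow \<alpha> \<beta> \<rho> \<mu> \<eta> k P' X' u'"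
    using flow unfolding bounded_flow_def P'_def X'_def u'_def
    by (auto intro!: transfer)
  show "P' \<in> Cb" "X' \<in> Cb" "u' \<in> Cb"
    using flow unfolding P'_def X'_def u'_def bounded_flow_def by (auto intro!: Cb)
qed

lemma Cb_eqI:
  assumes "f \<in> Cb" "g \<in> Cb" "\<And>t. 0 \<le> t \<Longrightarrow> f t = g t"
  shows "f = g"
  using assms by (auto simp: Cb_def intro: extensionalityI)

lemma (in factored_mean_field) mf_system_ex1_solution:
  assumes "\<eta> = 1 - lam * \<gamma>" "k = (1 - c) / (2 * r)"
  shows "\<exists>!(P, X, u). P \<in> Cb \<and> X \<in> Cb \<and> u \<in> Cb \<and> mf_system \<alpha> \<beta> \<rho> \<mu> \<gamma> lam r c p0 x0 P X u"
proof -
  have iff: "P \<in> Cb \<and> X \<in> Cb \<and> u \<in> Cb \<and> mf_system \<alpha> \<beta> \<rho> \<mu> \<gamma> lam r c p0 x0 P X u \<longleftrightarrow>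
      P \<in> Cb \<and> X \<in> Cb \<and> u \<in> Cb \<and> bounded_flow \<alpha> \<beta> \<rho> \<mu> \<eta> k P X u \<and> P 0 = p0 \<and> X 0 = x0" for P X u
    using mf_system_iff_bounded_flow[of P X u \<mu> \<rho>] add_pos_pos[OF pos(3,2)]
    unfolding assms by blast
  obtain P X u where flow: "bounded_flow \<alpha> \<beta> \<rho> \<mu> \<eta> k P X u" "P 0 = p0" "X 0 = x0"
    by (rule bounded_flow_exists)
  define P' X' u' where "P' = restrict P {0..}" and "X' = restrict X {0..}" and "u' = restrict u {0..}"
  note defs = P'_def X'_def u'_def
  have sol: "P' \<in> Cb" "X' \<in> Cb" "u' \<in> Cb" "bounded_flow \<alpha> \<beta> \<rho> \<mu> \<eta> k P' X' u'" "P' 0 = p0" "X' 0 = x0"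
    using bounded_flow_restrict[OF flow(1)] flow unfolding defs by auto
  have uniq: "Q = P' \<and> Z = X' \<and> v = u'"
    if "Q \<in> Cb" "Z \<in> Cb" "v \<in> Cb" "bounded_flow \<alpha> \<beta> \<rho> \<mu> \<eta> k Q Z v" "Q 0 = p0" "Z 0 = x0" for Q Z v
  proof -
    have "Q 0 = P' 0" "Z 0 = X' 0" using that sol by simp_all
    note same = bounded_flow_unique[OF that(4) sol(4) this]
    show ?thesis
      using Cb_eqI[OF that(1) sol(1) same(1)] Cb_eqI[OF that(2) sol(2) same(2)]
        Cb_eqI[OF that(3) sol(3) same(3)] by blast
  qed
  show ?thesis
    unfolding iff
  proof (rule ex1I[of _ "(P', X', u')"])
    show "case (P', X', u') of (P, X, u) \<Rightarrow>
        P \<in> Cb \<and> X \<in> Cb \<and> u \<in> Cb \<and> bounded_flow \<alpha> \<beta> \<rho> \<mu> \<eta> k P X u \<and> P 0 = p0 \<and> X 0 = x0"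
      unfolding prod.case using sol by blast
  next
    fix y
    assume "case y of (P, X, u) \<Rightarrow>
        P \<in> Cb \<and> X \<in> Cb \<and> u \<in> Cb \<and> bounded_flow \<alpha> \<beta> \<rho> \<mu> \<eta> k P X u \<and> P 0 = p0 \<and> X 0 = x0"
    then show "y = (P', X', u')"
      by (cases y) (use uniq in blast)
  qed
qed

theorem theorem3p3:
  fixes \<alpha> \<beta> \<rho> p0 x0 \<mu> \<sigma> \<gamma> lam r c :: real
    and \<mu>s \<sigma>s \<gamma>s lams rs cs :: "nat \<Rightarrow> real"
  assumes "\<alpha> > 0" "\<beta> > 0" "\<rho> > 0" "p0 > 0"
    and "\<mu> > 0" "\<sigma> > 0" "\<gamma> > 0" "lam > 0" "r > 0" "c > 0"
    and "(\<lambda>i. (\<mu>s i, \<sigma>s i, \<gamma>s i, lams i, rs i, cs i)) \<longlonglongrightarrow> (\<mu>, \<sigma>, \<gamma>, lam, r, c)"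
    and "\<And>i. \<mu>s i > 0 \<and> \<sigma>s i > 0 \<and> \<gamma>s i > 0 \<and> lams i > 0 \<and> rs i > 0 \<and> cs i > 0"
    and "\<And>i. cs i < 1"
    and "\<And>i. (\<sigma>s i)\<^sup>2 < 2 * \<mu>s i"
    and "\<And>i. 1 - \<gamma>s i * lams i > 0"
  defines "A \<equiv> coeff_A \<alpha> \<rho> \<mu>"
    and "B \<equiv> coeff_B \<alpha> \<rho> \<mu> \<gamma> lam r c"
  defines "\<Delta> \<equiv> cubic_discr \<alpha> \<rho> A B"
    and "R \<equiv> cubic_roots \<alpha> \<rho> A B"
    and "ps \<equiv> p_star \<alpha> \<beta> \<rho> \<mu> B"
  shows
    "(\<exists>!(P, X, u). P \<in> Cb \<and> X \<in> Cb \<and> u \<in> Cb \<and> mf_system \<alpha> \<beta> \<rho> \<mu> \<gamma> lam r c p0 x0 P X u) \<and>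
     (\<forall>P\<in>Cb. \<forall>X\<in>Cb. \<forall>u\<in>Cb. mf_system \<alpha> \<beta> \<rho> \<mu> \<gamma> lam r c p0 x0 P X u \<longrightarrow>
       (\<Delta> > 0 \<longrightarrow>
         (\<exists>K1 K2 K3::real. R = {of_real K1, of_real K2, of_real K3} \<and> K1 < K2 \<and> K2 < 0 \<and> 0 < K3) \<and>
         (\<forall>K1 K2 K3::real.
           R = {of_real K1, of_real K2, of_real K3} \<and> K1 < K2 \<and> K2 < 0 \<and> 0 < K3 \<longrightarrow>
           (\<forall>t\<ge>0. P t =
              (- \<alpha> * (\<beta> - (1 - lam * \<gamma>) * x0 - p0) + (p0 - ps) * K2) / (K2 - K1) * exp (K1 * t)
              + (\<alpha> * (\<beta> - (1 - lam * \<gamma>) * x0 - p0) - (p0 - ps) * K1) / (K2 - K1) * exp (K2 * t)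
              + ps))) \<and>
       (\<Delta> = 0 \<longrightarrow>
         (\<exists>K1 K2::real. R = {of_real K1, of_real K2} \<and> K1 < 0 \<and> 0 < K2) \<and>
         (\<forall>K1 K2::real.
           R = {of_real K1, of_real K2} \<and> K1 < 0 \<and> 0 < K2 \<longrightarrow>
           (\<forall>t\<ge>0. P t =
              ps + exp (K1 * t) *
                (p0 - ps + (\<alpha> * (\<beta> - (1 - lam * \<gamma>) * x0 - p0) - K1 * (p0 - ps)) * t)))) \<and>
       (\<Delta> < 0 \<longrightarrow>
         (\<exists>KR KI K3::real. R = {Complex KR KI, Complex KR (- KI), of_real K3} \<and>
            KR < 0 \<and> KI \<noteq> 0 \<and> 0 < K3) \<and>
         (\<forall>KR KI K3::real.
           R = {Complex KR KI, Complex KR (- KI), of_real K3} \<and> KR < 0 \<and> KI \<noteq> 0 \<and> 0 < K3 \<longrightarrow>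
           (\<forall>t\<ge>0. P t =
              ps + exp (KR * t) *
                ((p0 - ps) * cos (KI * t)
                 + (\<alpha> * (\<beta> - (1 - lam * \<gamma>) * x0 - p0) - (p0 - ps) * KR) / KI * sin (KI * t))))))"
proof -
  define \<eta> k q where "\<eta> = 1 - lam * \<gamma>" and "k = (1 - c) / (2 * r)"
    and "q = \<alpha> * (\<beta> - (1 - lam * \<gamma>) * x0 - p0)"
  note lim = assms(11)
  have "\<gamma>s \<longlonglongrightarrow> \<gamma>"
    using tendsto_fst[OF tendsto_snd[OF tendsto_snd[OF lim]]] by simp
  moreover have "lams \<longlonglongrightarrow> lam"
    using tendsto_fst[OF tendsto_snd[OF tendsto_snd[OF tendsto_snd[OF lim]]]] by simp
  ultimately have "(\<lambda>i. 1 - \<gamma>s i * lams i) \<longlonglongrightarrow> 1 - \<gamma> * lam"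
    by (intro tendsto_intros)
  then have "0 \<le> 1 - \<gamma> * lam"
    by (rule LIMSEQ_le_const) (use assms(15) less_imp_le in blast)
  then have \<eta>: "\<eta> \<ge> 0" by (simp add: \<eta>_def mult.commute)
  have "cs \<longlonglongrightarrow> c"
    using tendsto_snd[OF tendsto_snd[OF tendsto_snd[OF tendsto_snd[OF tendsto_snd[OF lim]]]]] by simp
  then have "c \<le> 1"
    by (rule LIMSEQ_le_const2) (use assms(13) less_imp_le in blast)
  then have k: "k \<ge> 0" using assms(9) by (simp add: k_def)
  have B: "B = \<alpha> * (\<mu> * (\<mu> + \<rho>) + \<eta> * k)"
    by (simp add: B_def coeff_B_def \<eta>_def k_def)
  obtain \<kappa> s d where cubic: "factored_cubic \<alpha> \<rho> A B \<kappa> s d"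
    using cubic_factorization[of \<alpha> \<rho> \<mu> "\<eta> * k"] assms(1,3,5) \<eta> k unfolding A_def B by auto
  interpret factored_cubic \<alpha> \<rho> A B \<kappa> s d by (rule cubic)
  interpret factored_mean_field \<alpha> \<rho> A B \<kappa> s d \<beta> \<mu> \<eta> k ps
  proof
    have "B \<noteq> 0" using root_prod signs by auto
    then show "ps * B = \<alpha> * \<mu> * \<beta> * (\<mu> + \<rho>)" by (simp add: ps_def p_star_def)
  qed (use assms B A_def in auto)
  have discr: "\<Delta> > 0 \<longleftrightarrow> s\<^sup>2 > 4 * d" "\<Delta> = 0 \<longleftrightarrow> s\<^sup>2 = 4 * d" "\<Delta> < 0 \<longleftrightarrow> s\<^sup>2 < 4 * d"
    using discr_sign unfolding \<Delta>_def by (auto simp: sgn_if split: if_splits)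
  have price: "P t = ps + Y t"
    if "P \<in> Cb" "X \<in> Cb" "u \<in> Cb" "mf_system \<alpha> \<beta> \<rho> \<mu> \<gamma> lam r c p0 x0 P X u"
      "\<exists>V. oscillator s d Y V \<and> Y 0 = p0 - ps \<and> V 0 = q" "0 \<le> t" for P X u Y t
  proof -
    have "bounded_flow \<alpha> \<beta> \<rho> \<mu> \<eta> k P X u" "P 0 = p0" "X 0 = x0"
      using mf_system_iff_bounded_flow[OF that(1-3), of \<mu> \<rho>] that(4) assms(3,5)
      by (auto simp: \<eta>_def k_def)
    then show ?thesis
      using bounded_flow_price that(5,6) unfolding q_def \<eta>_def by metis
  qed
  show ?thesis
    unfolding mult_minus_left q_def[symmetric]
  proof (intro conjI ballI impI allI)
    show "\<exists>!(P, X, u). P \<in> Cb \<and> X \<in> Cb \<and> u \<in> Cb \<and> mf_system \<alpha> \<beta> \<rho> \<mu> \<gamma> lam r c p0 x0 P X u"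
      by (rule mf_system_ex1_solution[OF \<eta>_def k_def])
  next
    assume "\<Delta> > 0"
    then show "\<exists>K1 K2 K3::real. R = {of_real K1, of_real K2, of_real K3} \<and> K1 < K2 \<and> K2 < 0 \<and> 0 < K3"
      using discr_pos_roots signs(1) unfolding discr R_def by blast
  next
    assume "\<Delta> = 0"
    then have "R = {of_real (s / 2), of_real \<kappa>}" "s / 2 < 0"
      using discr_zero_roots signs unfolding discr R_def by auto
    then show "\<exists>K1 K2::real. R = {of_real K1, of_real K2} \<and> K1 < 0 \<and> 0 < K2"
      using signs(1) by blast
  next
    assume "\<Delta> < 0"
    then show "\<exists>KR KI K3::real. R = {Complex KR KI, Complex KR (- KI), of_real K3} \<and>
        KR < 0 \<and> KI \<noteq> 0 \<and> 0 < K3"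
      using discr_neg_roots signs(1) unfolding discr R_def by blast
  next
    fix P X u and K1 K2 K3 t :: real
    assume sol: "P \<in> Cb" "X \<in> Cb" "u \<in> Cb" "mf_system \<alpha> \<beta> \<rho> \<mu> \<gamma> lam r c p0 x0 P X u"
      and K: "R = {of_real K1, of_real K2, of_real K3} \<and> K1 < K2 \<and> K2 < 0 \<and> 0 < K3" and t: "0 \<le> t"
    then have "K1 + K2 = s" "K1 * K2 = d"
      using vieta_two_negative[of K1 K2] unfolding R_def by auto
    then show "P t = (- q + (p0 - ps) * K2) / (K2 - K1) * exp (K1 * t)
        + (q - (p0 - ps) * K1) / (K2 - K1) * exp (K2 * t) + ps"
      using price[OF sol _ t] oscillator_distinct_real[of K1 K2 q "p0 - ps"] K by fastforce
  next
    fix P X u and K1 K2 t :: real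
    assume sol: "P \<in> Cb" "X \<in> Cb" "u \<in> Cb" "mf_system \<alpha> \<beta> \<rho> \<mu> \<gamma> lam r c p0 x0 P X u"
      and \<Delta>: "\<Delta> = 0" and K: "R = {of_real K1, of_real K2} \<and> K1 < 0 \<and> 0 < K2" and t: "0 \<le> t"
    then have "2 * K1 = s" "K1\<^sup>2 = d"
      using vieta_double_negative[of K1] discr unfolding R_def by auto
    then show "P t = ps + exp (K1 * t) * (p0 - ps + (q - K1 * (p0 - ps)) * t)"
      using price[OF sol _ t] oscillator_double_real[of K1 "p0 - ps" q] by blast
  next
    fix P X u and KR KI K3 t :: real
    assume sol: "P \<in> Cb" "X \<in> Cb" "u \<in> Cb" "mf_system \<alpha> \<beta> \<rho> \<mu> \<gamma> lam r c p0 x0 P X u"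
      and K: "R = {Complex KR KI, Complex KR (- KI), of_real K3} \<and> KR < 0 \<and> KI \<noteq> 0 \<and> 0 < K3"
      and t: "0 \<le> t"
    then have "2 * KR = s" "KR\<^sup>2 + KI\<^sup>2 = d"
      using vieta_complex[of KR KI] unfolding R_def by auto
    then show "P t = ps + exp (KR * t) *
        ((p0 - ps) * cos (KI * t) + (q - (p0 - ps) * KR) / KI * sin (KI * t))"
      using price[OF sol _ t] oscillator_complex[of KI KR "p0 - ps" q] K by blast
  qed
qed

end
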